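(* Let $c_0 := \dfrac{6+\sqrt{6}}{9(2+\sqrt{6})^2} \approx 0.04742$. There exist constants $K > 0$ and $N_0$ such that the following holds for every integer $n \ge N_0$: whenever $$n = AB = (A+a_1)(B-b_1) = (A+a_2)(B-b_2) = (A+a_3)(B-b_3)$$ for integers $A, B, a_1, a_2, a_3, b_1, b_2, b_3$ with $1 \le B \le A$, $1 \le a_1 < a_2 < a_3$ and $1 \le b_1 < b_2 < b_3$, the ratio $R_4 := A/a_3^3$ satisfies $$R_4 \le c_0 + \frac{K}{n^{1/3}}.$$ Moreover, this bound is best possible, in the sense that the constant $c_0$ cannot be replaced by a smaller one: for every real $c < c_0$ there are arbitrarily large integers $n$ admitting such integers $A, B, a_i, b_i$ with $A/a_3^3 > c$. *)

theory Defs
  imports Complex_Main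
begin

definition four_close_factorizations ::
  "int \<Rightarrow> int \<Rightarrow> int \<Rightarrow> int \<Rightarrow> int \<Rightarrow> int \<Rightarrow> int \<Rightarrow> int \<Rightarrow> int \<Rightarrow> bool" where
  "four_close_factorizations n A B a1 a2 a3 b1 b2 b3 \<longleftrightarrow>
     n = A * B \<and> n = (A + a1) * (B - b1) \<and> n = (A + a2) * (B - b2) \<and> n = (A + a3) * (B - b3) \<and>
     1 \<le> B \<and> B \<le> A \<and>
     1 \<le> a1 \<and> a1 < a2 \<and> a2 < a3 \<and>
     1 \<le> b1 \<and> b1 < b2 \<and> b2 < b3"

definition R4 :: "int \<Rightarrow> int \<Rightarrow> real" where
  "R4 A a3 = real_of_int A / real_of_int a3 ^ 3"

definition c0 :: real where
  "c0 = (6 + sqrt 6) / (9 * (2 + sqrt 6)\<^sup>2)"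

end

theory Submission
  imports Defs
begin

text \<open>The four lattice points \<open>(A + a\<^sub>i, B - b\<^sub>i)\<close> lie on the hyperbola \<open>x y = n\<close> and span
  triangles with positive integral determinants \<open>p, q, p + m, q + m\<close>.  If \<open>R\<^sub>4 > c\<^sub>0\<close> then
  the area of an inscribed quadrilateral forces \<open>p + q + m \<le> 6\<close>, and \<open>p = q\<close> would make two
  chords parallel, which is impossible for points this close together.  When \<open>p = 1\<close> or
  \<open>q = 1\<close>, two consecutive gap vectors form a unimodular basis, and the hyperbola condition
  says that their coordinate rows \<open>d\<close> and \<open>e\<close> are orthogonal for an explicit indefinite binary
  form of determinant \<open>- D\<close>.  Then \<open>N(d) N(e) = - D\<close>, so \<open>N(d)\<close> divides \<open>D\<close> and the slope
  \<open>e\<^sub>2 / d\<^sub>2\<close>, being below 1, is about \<open>\<surd>(D / N(d)\<^sup>2) \<le> \<surd>(2 / 3)\<close>.  The case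
  \<open>{p, q} = {1, 2}, m = 2\<close> is extremal; there \<open>a\<^sub>3 = \<bar>N(d)\<bar> e\<^sub>2\<close> yields \<open>R\<^sub>4 \<le> c\<^sub>0\<close> exactly, and
  the solutions of the Pell equation \<open>x\<^sup>2 - 6 y\<^sup>2 = 1\<close> come arbitrarily close to \<open>c\<^sub>0\<close>.\<close>

section \<open>Numerical estimates for \<open>c0\<close>\<close>

lemma c0_alt: "c0 = 1 - 7 * sqrt 6 / 18"
proof -
  have "sqrt 6 * sqrt 6 = (6::real)" by simp
  then have "6 + sqrt 6 = (1 - 7 * sqrt 6 / 18) * (9 * (2 + sqrt 6)\<^sup>2)"
    by (simp add: field_simps power2_eq_square)
  moreover have "0 < 2 + sqrt (6::real)" by (simp add: add_pos_pos)
  then have "2 + sqrt (6::real) \<noteq> 0" by linarith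
  ultimately show ?thesis unfolding c0_def by (simp add: divide_eq_eq)
qed

lemma sqrt6_less: "sqrt 6 < 2.4495"
  by (rule real_less_lsqrt; simp add: power2_eq_square)

lemma c0_gt: "c0 > 4741 / 100000"
  using sqrt6_less unfolding c0_alt by simp

section \<open>Orthogonal unimodular pairs for binary quadratic forms\<close>

text \<open>The Gram determinant of \<open>u\<close> and \<open>w\<close> is the determinant of the
  form times the squared determinant of the pair. As the mixed entry vanishes, the values at
  \<open>u\<close> and \<open>w\<close> multiply to \<alpha>\<gamma> - \<beta>^2. The last claim
  squares the second and completes the square.\<close>

lemma orthogonal_pair:
  fixes \<alpha> \<beta> \<gamma> u1 u2 w1 w2 :: int
  assumes orth: "\<alpha> * u1 * w1 - \<beta> * (u1 * w2 + u2 * w1) + \<gamma> * u2 * w2 = 0"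
    and det: "(u1 * w2 - u2 * w1)\<^sup>2 = 1"
  defines "N \<equiv> \<alpha> * u1\<^sup>2 - 2 * \<beta> * u1 * u2 + \<gamma> * u2\<^sup>2"
  shows "N dvd \<beta>\<^sup>2 - \<alpha> * \<gamma>"
    and "N * w2 = (\<alpha> * u1 - \<beta> * u2) * (u1 * w2 - u2 * w1)"
    and "N\<^sup>2 * w2\<^sup>2 = (\<beta>\<^sup>2 - \<alpha> * \<gamma>) * u2\<^sup>2 + \<alpha> * N"
proof -
  have "N * (\<alpha> * w1\<^sup>2 - 2 * \<beta> * w1 * w2 + \<gamma> * w2\<^sup>2) =
      (\<alpha> * u1 * w1 - \<beta> * (u1 * w2 + u2 * w1) + \<gamma> * u2 * w2)\<^sup>2
      - (\<beta>\<^sup>2 - \<alpha> * \<gamma>) * (u1 * w2 - u2 * w1)\<^sup>2"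
    unfolding N_def by algebra
  then have "\<beta>\<^sup>2 - \<alpha> * \<gamma> = N * - (\<alpha> * w1\<^sup>2 - 2 * \<beta> * w1 * w2 + \<gamma> * w2\<^sup>2)"
    unfolding orth det by (simp add: algebra_simps)
  then show "N dvd \<beta>\<^sup>2 - \<alpha> * \<gamma>" by (rule dvdI)
  show N_w2: "N * w2 = (\<alpha> * u1 - \<beta> * u2) * (u1 * w2 - u2 * w1)"
    using orth unfolding N_def by algebra
  have "N\<^sup>2 * w2\<^sup>2 = (\<alpha> * u1 - \<beta> * u2)\<^sup>2"
    using N_w2 det by (metis mult.right_neutral power_mult_distrib)
  also have "\<dots> = (\<beta>\<^sup>2 - \<alpha> * \<gamma>) * u2\<^sup>2 + \<alpha> * N"
    unfolding N_def by algebra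
  finally show "N\<^sup>2 * w2\<^sup>2 = (\<beta>\<^sup>2 - \<alpha> * \<gamma>) * u2\<^sup>2 + \<alpha> * N" .
qed

text \<open>By the previous lemma \<open>(w2 / u2)^2\<close> equals \<open>D / N^2\<close> up to the
  error \<alpha> \<open>/ (N * u2^2)\<close>, and \<open>N\<close> is bounded because it divides
  \<open>D\<close>. So for large \<open>u2\<close> the slope is nearly determined by the divisor
  \<open>N\<close>.\<close>

lemma orthogonal_pair_slope:
  fixes \<alpha> \<beta> \<gamma> u1 u2 w1 w2 :: int
  assumes orth: "\<alpha> * u1 * w1 - \<beta> * (u1 * w2 + u2 * w1) + \<gamma> * u2 * w2 = 0"
    and det: "(u1 * w2 - u2 * w1)\<^sup>2 = 1"
    and D: "\<beta>\<^sup>2 - \<alpha> * \<gamma> = D" "0 < D"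
    and w2: "0 < w2" "w2 < u2" and large: "\<bar>\<alpha>\<bar> * D < u2\<^sup>2"
  defines "N \<equiv> \<alpha> * u1\<^sup>2 - 2 * \<beta> * u1 * u2 + \<gamma> * u2\<^sup>2"
  shows "N dvd D" and "D \<le> N\<^sup>2"
    and "\<lbrakk>0 \<le> k; k * D \<le> l * N\<^sup>2\<rbrakk> \<Longrightarrow> k * w2\<^sup>2 \<le> l * u2\<^sup>2 + k * \<bar>\<alpha>\<bar>"
proof -
  note facts = orthogonal_pair[OF orth det, folded N_def, unfolded D(1)]
  show dvd: "N dvd D" by (fact facts(1))
  then have N: "\<bar>N\<bar> \<le> D" "N \<noteq> 0"
    using D(2) dvd_imp_le_int[of D N] by auto
  have "\<bar>\<alpha> * N\<bar> \<le> \<bar>\<alpha>\<bar> * D" using N(1) by (simp add: abs_mult mult_left_mono)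
  then have small: "- (u2\<^sup>2) < \<alpha> * N" using large by linarith
  have "w2\<^sup>2 \<le> u2\<^sup>2" using w2 by simp
  then have "N\<^sup>2 * w2\<^sup>2 \<le> N\<^sup>2 * u2\<^sup>2" by (simp add: mult_left_mono)
  \<comment> \<open>A slope below 1 forces \<open>D * u2^2\<close> + \<alpha> \<open>N\<close> to be
    at most \<open>N^2 * u2^2\<close>, and the error term costs less than one
    \<open>u2^2\<close>.\<close>
  then have "(D - 1) * u2\<^sup>2 < N\<^sup>2 * u2\<^sup>2" using facts(3) small by (simp add: algebra_simps)
  then have "D - 1 < N\<^sup>2" using w2 by (simp add: mult_less_cancel_right)
  then show "D \<le> N\<^sup>2" by simp
  assume k: "0 \<le> k" "k * D \<le> l * N\<^sup>2"
  have "\<bar>N\<bar> * 1 \<le> \<bar>N\<bar> * \<bar>N\<bar>" using N(2) by (intro mult_left_mono) auto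
  then have "\<bar>N\<bar> \<le> N\<^sup>2" by (simp add: power2_eq_square flip: abs_mult)
  then have "\<bar>\<alpha>\<bar> * \<bar>N\<bar> \<le> \<bar>\<alpha>\<bar> * N\<^sup>2" by (intro mult_left_mono) auto
  then have "\<alpha> * N \<le> \<bar>\<alpha>\<bar> * N\<^sup>2"
    using abs_ge_self[of "\<alpha> * N"] by (simp add: abs_mult)
  then have "k * (\<alpha> * N) \<le> k * (\<bar>\<alpha>\<bar> * N\<^sup>2)" using k(1) by (rule mult_left_mono)
  moreover have "k * D * u2\<^sup>2 \<le> l * N\<^sup>2 * u2\<^sup>2" using k(2) by (rule mult_right_mono) simp
  moreover have "k * (N\<^sup>2 * w2\<^sup>2) = k * D * u2\<^sup>2 + k * (\<alpha> * N)"
    unfolding facts(3) by (simp add: algebra_simps)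
  ultimately have "N\<^sup>2 * (k * w2\<^sup>2) \<le> N\<^sup>2 * (l * u2\<^sup>2 + k * \<bar>\<alpha>\<bar>)"
    by (simp add: algebra_simps)
  then show "k * w2\<^sup>2 \<le> l * u2\<^sup>2 + k * \<bar>\<alpha>\<bar>" using N(2) by simp
qed

text \<open>A finite check. The worst ratio \<open>D / N^2\<close> is 2/3, reached at
  \<open>D = 6\<close>, \<open>N = 3\<close>; for \<open>D = 3\<close> only \<open>N = 3\<close> or
  \<open>N = -3\<close> remains.\<close>

lemma dvd_square_ge:
  fixes N D :: int
  assumes "N dvd D" "D \<le> N\<^sup>2" "D \<in> {3, 5, 6, 10}"
  shows "3 \<le> \<bar>N\<bar>" "3 * D \<le> 2 * N\<^sup>2" "D = 3 \<Longrightarrow> 3 * D \<le> 1 * N\<^sup>2"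
proof -
  have "\<bar>N\<bar> \<le> D" using assms dvd_imp_le_int[of D N] by auto
  then have "\<bar>N\<bar> \<in> {0..10}" using assms by auto
  then have "\<bar>N\<bar> \<in> {0,1,2,3,4,5,6,7,8,9,10}" by (simp; presburger)
  moreover have "\<bar>N\<bar> dvd D" "D \<le> \<bar>N\<bar>\<^sup>2" using assms by auto
  ultimately have "3 \<le> \<bar>N\<bar> \<and> 3 * D \<le> 2 * \<bar>N\<bar>\<^sup>2 \<and> (D = 3 \<longrightarrow> 3 * D \<le> \<bar>N\<bar>\<^sup>2)"
    using assms(3) by (elim insertE emptyE) (simp_all)
  then show "3 \<le> \<bar>N\<bar>" "3 * D \<le> 2 * N\<^sup>2" "D = 3 \<Longrightarrow> 3 * D \<le> 1 * N\<^sup>2" by auto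
qed

text \<open>Dividing out common factors of the coefficients leaves six forms, with \<open>D\<close>
  in {3, 5, 6, 10} and leading coefficient at most 6; the error 18 is 3 * 6. For
  \<open>k = m = 2\<close> the value of the form itself is kept, since that case is
  extremal.\<close>

lemma gap_form_slope:
  fixes k m u1 u2 w1 w2 :: int
  assumes orth: "k * (k - 1) * (u1 * w1) - k * (m + 1) * (u1 * w2 + u2 * w1)
      + m * (m + 1) * (u2 * w2) = 0"
    and det: "(u1 * w2 - u2 * w1)\<^sup>2 = 1"
    and w2: "0 < w2" "w2 < u2" and large: "47 \<le> u2"
    and km: "2 \<le> k" "1 \<le> m" "k + m \<le> 5"
  shows "3 * w2\<^sup>2 \<le> 2 * u2\<^sup>2 + 18"
    and "\<lbrakk>k = 2; m = 1\<rbrakk> \<Longrightarrow> 3 * w2\<^sup>2 \<le> u2\<^sup>2 + 18"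
    and "\<lbrakk>k = 2; m = 2\<rbrakk> \<Longrightarrow> 3 \<le> \<bar>u1\<^sup>2 - 6 * u1 * u2 + 3 * u2\<^sup>2\<bar>"
proof -
  have "47\<^sup>2 \<le> u2\<^sup>2" using large by (intro power_mono) auto
  then have sq: "2209 \<le> u2\<^sup>2" by simp
  have form: "3 \<le> \<bar>\<alpha> * u1\<^sup>2 - 2 * \<beta> * u1 * u2 + \<gamma> * u2\<^sup>2\<bar> \<and>
      3 * w2\<^sup>2 \<le> 2 * u2\<^sup>2 + 18 \<and> (D = 3 \<longrightarrow> 3 * w2\<^sup>2 \<le> u2\<^sup>2 + 18)"
    if "\<alpha> * u1 * w1 - \<beta> * (u1 * w2 + u2 * w1) + \<gamma> * u2 * w2 = 0"
      "\<beta>\<^sup>2 - \<alpha> * \<gamma> = D" "D \<in> {3, 5, 6, 10}" "\<bar>\<alpha>\<bar> \<le> 6" for \<alpha> \<beta> \<gamma> D :: int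
  proof -
    have D: "0 < D" "D \<le> 10" using that(3) by auto
    have "\<bar>\<alpha>\<bar> * D \<le> 6 * 10" using that(4) D by (intro mult_mono) auto
    then have "\<bar>\<alpha>\<bar> * D < u2\<^sup>2" using sq by simp
    note slope = orthogonal_pair_slope[OF that(1) det that(2) D(1) w2 this]
    note N = dvd_square_ge[OF slope(1,2) that(3)]
    show ?thesis
      using N(1) slope(3)[OF _ N(2)] slope(3)[OF _ N(3)] that(4) by auto
  qed
  have "(k, m) \<in> {(2,1), (2,2), (2,3), (3,1), (3,2), (4,1)}"
    using km by (simp; presburger)
  then consider "k = 2" "m = 1" | "k = 2" "m = 2" | "k = 2" "m = 3"
    | "k = 3" "m = 1" | "k = 3" "m = 2" | "k = 4" "m = 1" by auto
  then have "3 * w2\<^sup>2 \<le> 2 * u2\<^sup>2 + 18 \<and> (k = 2 \<and> m = 1 \<longrightarrow> 3 * w2\<^sup>2 \<le> u2\<^sup>2 + 18) \<and>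
    (k = 2 \<and> m = 2 \<longrightarrow> 3 \<le> \<bar>u1\<^sup>2 - 6 * u1 * u2 + 3 * u2\<^sup>2\<bar>)"
  proof cases
    case 1 then show ?thesis using form[of 1 2 1 3] orth by simp
  next
    case 2 then show ?thesis using form[of 1 3 3 6] orth by (simp add: algebra_simps)
  next
    case 3 then show ?thesis using form[of 1 4 6 10] orth by simp
  next
    case 4 then show ?thesis using form[of 3 3 1 6] orth by simp
  next
    case 5 then show ?thesis using form[of 2 3 2 5] orth by simp
  next
    case 6 then show ?thesis using form[of 6 4 1 10] orth by simp
  qed
  then show "3 * w2\<^sup>2 \<le> 2 * u2\<^sup>2 + 18"
    and "\<lbrakk>k = 2; m = 1\<rbrakk> \<Longrightarrow> 3 * w2\<^sup>2 \<le> u2\<^sup>2 + 18"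
    and "\<lbrakk>k = 2; m = 2\<rbrakk> \<Longrightarrow> 3 \<le> \<bar>u1\<^sup>2 - 6 * u1 * u2 + 3 * u2\<^sup>2\<bar>" by auto
qed

section \<open>Areas of polygons inscribed in a parabola\<close>

text \<open>The two summands are normalized areas of the triangles into which a diagonal cuts the
  quadrilateral. Equal gaps of 1/3 are optimal: first \<open>t1 = t2\<close> for fixed
  \<open>t3\<close>, then a cubic in \<open>t3\<close> with a double root at 1/3.\<close>

lemma inscribed_quadrilateral_area:
  fixes t1 t2 t3 :: real
  assumes "t1 + t2 + t3 = 1" "0 \<le> t3" "t3 \<le> 1"
  shows "t1 * t2 * (t1 + t2) + t3 * (t1 + t2) \<le> 8 / 27"
proof -
  have t: "t2 = 1 - t1 - t3" using assms(1) by simp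
  have "t1 * t2 + t3 = (1 + t3)\<^sup>2 / 4 - (t1 - (1 - t3) / 2)\<^sup>2"
    unfolding t by (simp add: field_simps power2_eq_square)
  then have "t1 * t2 + t3 \<le> (1 + t3)\<^sup>2 / 4" by simp
  then have "(1 - t3) * (t1 * t2 + t3) \<le> (1 - t3) * ((1 + t3)\<^sup>2 / 4)"
    using assms(3) by (intro mult_left_mono) auto
  moreover have "8 / 27 - (1 - t3) * ((1 + t3)\<^sup>2 / 4) = (t3 - 1 / 3)\<^sup>2 * (t3 + 5 / 3) / 4"
    by (simp add: field_simps power2_eq_square)
  moreover have "0 \<le> (t3 - 1 / 3)\<^sup>2 * (t3 + 5 / 3) / 4" using assms(2) by simp
  moreover have "t1 * t2 * (t1 + t2) + t3 * (t1 + t2) = (1 - t3) * (t1 * t2 + t3)"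
    unfolding t by (simp add: algebra_simps)
  ultimately show ?thesis by linarith
qed

text \<open>A large triangle using the gap \<open>x\<close> keeps \<open>x\<close> in
  \<open>[c, 1 - c]\<close>; the other two gaps then share at most \<open>1 - c\<close>, and AM-GM
  bounds their triangle.\<close>

lemma inscribed_triangle_area:
  fixes x y z c :: real
  assumes "x + y + z = 1" "0 \<le> y" "0 \<le> z" "0 \<le> c" "c \<le> 1 / 2" "c * (1 - c) \<le> x * (1 - x)"
  shows "y * z * (y + z) \<le> (1 - c) ^ 3 / 4"
proof -
  have "c \<le> x"
  proof (rule ccontr)
    assume "\<not> c \<le> x"
    then have "0 < (c - x) * (1 - c - x)" using assms(5) by (intro mult_pos_pos) auto
    then show False using assms(6) by (simp add: algebra_simps)
  qed
  then have yz: "y + z \<le> 1 - c" using assms(1) by simp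
  have "4 * (y * z) \<le> (y + z)\<^sup>2" using sum_squares_bound[of y z] by (simp add: power2_sum)
  then have "4 * (y * z) * (y + z) \<le> (y + z)\<^sup>2 * (y + z)"
    using assms(2,3) by (intro mult_right_mono) auto
  also have "\<dots> = (y + z) ^ 3" by (simp add: power2_eq_square power3_eq_cube)
  also have "\<dots> \<le> (1 - c) ^ 3" using yz assms(2,3) by (intro power_mono) auto
  finally show ?thesis by simp
qed

lemma normalize_area:
  fixes A :: real
  assumes "0 < d" "0 < a" "d * (k * A) \<le> e * (x * y * z)"
  shows "k * (A / a ^ 3) \<le> e / d * ((x / a) * (y / a) * (z / a))"
  using assms by (simp add: field_simps power3_eq_cube)

text \<open>Here \<open>v\<close> stands for \<open>d2 / a3\<close>. Both products have nonnegative
  factors that are monotone in \<open>v\<close>, and both take the value \<open>3 * c0\<close> at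
  the endpoint \<open>v = 1 / sqrt 6\<close>.\<close>

lemma extremal_profiles:
  fixes v :: real
  shows "\<lbrakk>1 < 3 * v; 6 * v\<^sup>2 \<le> 1\<rbrakk> \<Longrightarrow> (3 * v - 1) * (4 * v - 1) \<le> 3 * c0"
    and "\<lbrakk>0 < v; 2 * v < 1; 1 \<le> 6 * v\<^sup>2\<rbrakk> \<Longrightarrow> (1 - 2 * v) * (2 - 3 * v) \<le> 3 * c0"
proof -
  have s: "sqrt 6 * sqrt 6 = (6::real)" by simp
  have sq: "(6 * v)\<^sup>2 = 6 * (6 * v\<^sup>2)" by (simp add: power2_eq_square)
  {
    assume v: "1 < 3 * v" "6 * v\<^sup>2 \<le> 1"
    have "6 * v \<le> sqrt 6" using v(2) by (intro real_le_rsqrt) (simp add: sq)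
    then have "(3 * v - 1) * (4 * v - 1) \<le> (3 * (sqrt 6 / 6) - 1) * (4 * (sqrt 6 / 6) - 1)"
      using v(1) by (intro mult_mono) auto
    also have "\<dots> = 3 * c0" unfolding c0_alt using s by (simp add: field_simps)
    finally show "(3 * v - 1) * (4 * v - 1) \<le> 3 * c0" .
  }
  {
    assume v: "0 < v" "2 * v < 1" "1 \<le> 6 * v\<^sup>2"
    have "sqrt 6 \<le> 6 * v" using v by (intro real_le_lsqrt) (simp_all add: sq)
    then have "(1 - 2 * v) * (2 - 3 * v) \<le> (1 - 2 * (sqrt 6 / 6)) * (2 - 3 * (sqrt 6 / 6))"
      using v(1,2) sqrt6_less by (intro mult_mono) auto
    also have "\<dots> = 3 * c0" unfolding c0_alt using s by (simp add: field_simps)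
    finally show "(1 - 2 * v) * (2 - 3 * v) \<le> 3 * c0" .
  }
qed

section \<open>Gap vectors of four points on a hyperbola\<close>

text \<open>The gaps between consecutive points are \<open>(d_i, - e_i)\<close>; each step equation
  is the equality of two consecutive products, with the common term cancelled.\<close>

locale four_hyperbola_points =
  fixes A B d1 d2 d3 e1 e2 e3 :: int
  assumes pos: "0 < d1" "0 < d2" "0 < d3" "0 < e1" "0 < e2" "0 < e3" "0 < A" "0 < B"
    and B_le_A: "B \<le> A"
    and step1: "d1 * B = e1 * (A + d1)"
    and step2: "d2 * (B - e1) = e2 * (A + d1 + d2)"
    and step3: "d3 * (B - e1 - e2) = e3 * (A + d1 + d2 + d3)"
begin

text \<open>Writing \<open>v\<^sub>i = (d\<^sub>i, e\<^sub>i)\<close>, the determinants of the four triangles formed by the points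
  are \<open>p\<close>, \<open>q\<close>, \<open>p + m\<close> and \<open>q + m\<close>.\<close>

definition "p = e1 * d2 - e2 * d1"
definition "q = e2 * d3 - e3 * d2"
definition "m = e1 * d3 - e3 * d1"

text \<open>On \<open>x y = n\<close> a triangle with abscissae \<open>x1 < x2 < x3\<close> has
  determinant \<open>n (x2 - x1) (x3 - x2) (x3 - x1) / (x1 x2 x3)\<close>. In each identity
  \<open>n\<close>, one gap in \<open>x\<close> and two abscissae are traded for the matching gap in
  \<open>y\<close>.\<close>

lemma areas:
  "A * p = d1 * (d1 + d2) * e2"
  "(A + d1) * q = d2 * (d2 + d3) * e3"
  "A * (p + m) = d1 * (d1 + d2 + d3) * (e2 + e3)"
  "A * (q + m) = (d1 + d2) * (d1 + d2 + d3) * e3"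
  "(A + d1 + d2 + d3) * q = d3 * (d2 + d3) * e2"
  "(A + d1 + d2 + d3) * (q + m) = d3 * (d1 + d2 + d3) * (e1 + e2)"
  unfolding p_def q_def m_def using step1 step2 step3 by algebra+

lemma pqm_pos: "1 \<le> p" "1 \<le> q" "1 \<le> m"
proof -
  have "0 < A * p" "0 < (A + d1) * q" unfolding areas using pos by simp_all
  then show "1 \<le> p" "1 \<le> q" using pos by (auto simp: zero_less_mult_iff)
  moreover have "d2 * m = d3 * p + d1 * q" unfolding p_def q_def m_def by algebra
  ultimately have "0 < d2 * m" using pos by (simp add: add_pos_pos)
  then show "1 \<le> m" using pos by (auto simp: zero_less_mult_iff)
qed

lemma e2_less: "e2 < d2"
proof (rule ccontr)
  assume "\<not> e2 < d2"
  then have "d2 * (A + d1 + d2) \<le> e2 * (A + d1 + d2)" using pos by (intro mult_right_mono) auto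
  moreover have "d2 * (B - e1) < d2 * (A + d1 + d2)"
    using pos B_le_A by (intro mult_strict_left_mono) auto
  ultimately show False using step2 by simp
qed

lemma plucker:
  "p * d3 = m * d2 - q * d1" "p * e3 = m * e2 - q * e1"
  "q * d1 = m * d2 - p * d3" "q * e1 = m * e2 - p * e3"
  unfolding p_def q_def m_def by algebra+

text \<open>If \<open>p = 1\<close>, the first two gap vectors generate the third. Comparing two
  triangles at the first point and sharing the factor \<open>A\<close> eliminates \<open>A\<close>,
  leaving a bilinear relation between \<open>(d1, d2)\<close> and \<open>(e1, e2)\<close>.\<close>

lemma gap_form_front:
  assumes "p = 1"
  shows "q * (q - 1) * (d1 * e1) - q * (m + 1) * (d1 * e2 + d2 * e1) + m * (m + 1) * (d2 * e2) = 0"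
proof -
  have "d1 * ((d1 + d2) * e2 * (1 + m)) = d1 * ((d1 + d2 + d3) * (e2 + e3))"
    using areas(1,3) assms by algebra
  then have "(d1 + d2) * e2 * (1 + m) = (d1 + d2 + d3) * (e2 + e3)" using pos by simp
  moreover have "d3 = m * d2 - q * d1" "e3 = m * e2 - q * e1" using plucker assms by auto
  ultimately show ?thesis by algebra
qed

text \<open>The mirror image: the basis is the last two gap vectors, and the triangles compared
  share the last point.\<close>

lemma gap_form_back:
  assumes "q = 1"
  shows "p * (p - 1) * (d3 * e3) - p * (m + 1) * (d3 * e2 + d2 * e3) + m * (m + 1) * (d2 * e2) = 0"
proof -
  have "d3 * ((d2 + d3) * e2 * (1 + m)) = d3 * ((d1 + d2 + d3) * (e1 + e2))"
    using areas(5,6) assms by algebra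
  then have "(d2 + d3) * e2 * (1 + m) = (d1 + d2 + d3) * (e1 + e2)" using pos by simp
  moreover have "d1 = m * d2 - p * d3" "e1 = m * e2 - p * e3" using plucker assms by auto
  ultimately show ?thesis by algebra
qed

text \<open>If \<open>p = q\<close>, the middle chord is parallel to the one joining the outer
  points. A chord's slope depends only on the product of its abscissae, so these products agree;
  this makes \<open>A\<close> a divisor of the positive number
  \<open>d1 * (d1 + d2)\<close>.\<close>

lemma parallel_chords:
  assumes "p = q"
  shows "A < (d1 + d2 + d3)\<^sup>2"
proof -
  have "d2 * (e1 + e2 + e3) = e2 * (d1 + d2 + d3)"
    using assms unfolding p_def q_def by algebra
  moreover have "(d1 + d2 + d3) * B = (e1 + e2 + e3) * (A + d1 + d2 + d3)"
    using step1 step2 step3 by algebra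
  moreover have "(B - e1) * (A + d1) = A * B" using step1 by algebra
  ultimately have "(d2 * (d1 + d2 + d3) * B) * ((A + d1) * (A + d1 + d2))
      = (d2 * (d1 + d2 + d3) * B) * (A * (A + d1 + d2 + d3))"
    using step2 by algebra
  then have "(A + d1) * (A + d1 + d2) = A * (A + d1 + d2 + d3)" using pos by simp
  then have eq: "A * (d3 - d1) = d1 * (d1 + d2)" by algebra
  have "0 < A * (d3 - d1)" unfolding eq using pos by simp
  then have "1 \<le> d3 - d1" using pos by (auto simp: zero_less_mult_iff)
  then have "A * 1 \<le> A * (d3 - d1)" using pos by (intro mult_left_mono) auto
  also have "\<dots> < (d1 + d2 + d3) * (d1 + d2 + d3)"
    unfolding eq using pos by (intro mult_strict_mono) auto
  finally show ?thesis by (simp add: power2_eq_square)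
qed

lemma e3_slope: "d2 * e3 \<le> e2 * d3"
  using pqm_pos(2) unfolding q_def by (simp add: algebra_simps)

text \<open>Convexity gives \<open>e3 / d3 <= e2 / d2\<close>, so all four determinants are bounded
  by the areas for a parabola, scaled by the middle slope \<open>e2 / d2\<close>.\<close>

lemma scaled_areas:
  "d2 * (p * A) \<le> e2 * (d1 * d2 * (d1 + d2))"
  "d2 * (q * A) \<le> e2 * (d2 * d3 * (d2 + d3))"
  "d2 * ((p + m) * A) \<le> e2 * (d1 * (d2 + d3) * (d1 + d2 + d3))"
  "d2 * ((q + m) * A) \<le> e2 * ((d1 + d2) * d3 * (d1 + d2 + d3))"
proof -
  show "d2 * (p * A) \<le> e2 * (d1 * d2 * (d1 + d2))"
    using areas(1) by (metis mult.assoc mult.commute order_refl)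
  have "d2 * (q * A) \<le> d2 * ((A + d1) * q)"
    using pos pqm_pos by (simp add: algebra_simps)
  also have "\<dots> = d2 * (d2 + d3) * (d2 * e3)" unfolding areas by algebra
  also have "\<dots> \<le> d2 * (d2 + d3) * (e2 * d3)"
    using pos e3_slope by (intro mult_left_mono) auto
  finally show "d2 * (q * A) \<le> e2 * (d2 * d3 * (d2 + d3))" by (simp add: algebra_simps)
  have "d2 * ((p + m) * A) = d1 * (d1 + d2 + d3) * (d2 * e2 + d2 * e3)"
    using areas(3) by algebra
  also have "\<dots> \<le> d1 * (d1 + d2 + d3) * (d2 * e2 + e2 * d3)"
    using pos e3_slope by (intro mult_left_mono) auto
  finally show "d2 * ((p + m) * A) \<le> e2 * (d1 * (d2 + d3) * (d1 + d2 + d3))"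
    by (simp add: algebra_simps)
  have "d2 * ((q + m) * A) = (d1 + d2) * (d1 + d2 + d3) * (d2 * e3)"
    using areas(4) by algebra
  also have "\<dots> \<le> (d1 + d2) * (d1 + d2 + d3) * (e2 * d3)"
    using pos e3_slope by (intro mult_left_mono) auto
  finally show "d2 * ((q + m) * A) \<le> e2 * ((d1 + d2) * d3 * (d1 + d2 + d3))"
    by (simp add: algebra_simps)
qed

section \<open>The two extremal configurations\<close>

text \<open>Since \<open>N * e2 = a\<close>, eliminating \<open>e2\<close> from the area identity
  for \<open>p\<close> makes \<open>R4 * N\<close> a function of \<open>v = d2 / a\<close> alone.
  Then \<open>N >= 3\<close> both bounds \<open>v\<close> by \<open>1 / sqrt 6\<close> and supplies
  the division by 3.\<close>

lemma extremal_front: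
  assumes "p = 1" "q = 2" "m = 2" and N: "3 \<le> \<bar>d1\<^sup>2 - 6 * d1 * d2 + 3 * d2\<^sup>2\<bar>"
  shows "R4 A (d1 + d2 + d3) \<le> c0"
proof -
  define a where "a = d1 + d2 + d3"
  define N where "N = d1\<^sup>2 - 6 * d1 * d2 + 3 * d2\<^sup>2"
  have a: "a = 3 * d2 - d1" "0 < a"
    using plucker assms(1-3) pos unfolding a_def by auto
  have det: "e1 * d2 - e2 * d1 = 1" using assms(1) unfolding p_def .
  have N_e2: "N * e2 = a"
    using gap_form_front[OF assms(1)] det unfolding assms(2,3) a(1) N_def by algebra
  then have "0 < N * e2" using a(2) by simp
  then have "3 \<le> N" using N pos unfolding N_def by (auto simp: zero_less_mult_iff)
  have N_eq: "N = a\<^sup>2 - 6 * d2\<^sup>2" unfolding N_def a(1) by algebra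
  have "A * N = d1 * (d1 + d2) * a" using areas(1) N_e2 assms(1) by algebra
  then have A: "real_of_int A * N = (3 * real_of_int d2 - a) * (4 * d2 - a) * a"
    unfolding a(1) by (simp flip: of_int_mult of_int_diff of_int_add of_int_eq_iff) (simp add: algebra_simps)
  define v where "v = real_of_int d2 / a"
  have "R4 A a * N = (3 * v - 1) * (4 * v - 1)"
    using A a(2) unfolding R4_def v_def by (simp add: field_simps power3_eq_cube)
  also have "\<dots> \<le> 3 * c0"
  proof (rule extremal_profiles(1))
    show "1 < 3 * v" using a pos unfolding v_def by (simp add: field_simps)
    have "real_of_int (6 * d2\<^sup>2) \<le> real_of_int (a\<^sup>2)"
      using N_eq \<open>3 \<le> N\<close> by (subst of_int_le_iff) linarith
    then show "6 * v\<^sup>2 \<le> 1" using a(2) unfolding v_def by (simp add: field_simps)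
  qed
  also have "\<dots> \<le> N * c0" using \<open>3 \<le> N\<close> c0_gt by (intro mult_right_mono) auto
  finally show ?thesis using \<open>3 \<le> N\<close> unfolding a_def by (simp add: mult.commute)
qed

lemma extremal_back:
  assumes "p = 2" "q = 1" "m = 2" and N: "3 \<le> \<bar>d3\<^sup>2 - 6 * d3 * d2 + 3 * d2\<^sup>2\<bar>"
  shows "R4 A (d1 + d2 + d3) \<le> c0"
proof -
  define a where "a = d1 + d2 + d3"
  \<comment> \<open>The reversed basis has the opposite orientation, so the sign is flipped to keep
    \<open>N * e2 = a\<close>; now \<open>v\<close> lies above \<open>1 / sqrt 6\<close>.\<close>
  define N where "N = - (d3\<^sup>2 - 6 * d3 * d2 + 3 * d2\<^sup>2)"
  have a: "a = 3 * d2 - d3" "0 < a"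
    using plucker assms(1-3) pos unfolding a_def by auto
  have det: "e2 * d3 - e3 * d2 = 1" using assms(2) unfolding q_def .
  have N_e2: "N * e2 = a"
    using gap_form_back[OF assms(2)] det unfolding assms(1,3) a(1) N_def by algebra
  then have "0 < N * e2" using a(2) by simp
  then have "3 \<le> N" using N pos unfolding N_def by (auto simp: zero_less_mult_iff)
  have N_eq: "N = 6 * d2\<^sup>2 - a\<^sup>2" unfolding N_def a(1) by algebra
  have d1: "d1 = 2 * d2 - 2 * d3" using plucker assms(1-3) by auto
  have "2 * (A * N) = 2 * ((d2 - d3) * (3 * d2 - 2 * d3) * a)"
    using areas(1) N_e2 assms(1) d1 by algebra
  then have "A * N = (a - 2 * d2) * (2 * a - 3 * d2) * a" unfolding a(1) by algebra
  then have A: "real_of_int A * N = (real_of_int a - 2 * d2) * (2 * a - 3 * d2) * a"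
    by (simp flip: of_int_mult of_int_diff of_int_add of_int_eq_iff)
  define v where "v = real_of_int d2 / a"
  have "R4 A a * N = (1 - 2 * v) * (2 - 3 * v)"
    using A a(2) unfolding R4_def v_def by (simp add: field_simps power3_eq_cube)
  also have "\<dots> \<le> 3 * c0"
  proof (rule extremal_profiles(2))
    show "0 < v" using a pos unfolding v_def by simp
    show "2 * v < 1" using a d1 pos unfolding v_def by (simp add: field_simps)
    have "real_of_int (a\<^sup>2) \<le> real_of_int (6 * d2\<^sup>2)"
      using N_eq \<open>3 \<le> N\<close> by (subst of_int_le_iff) linarith
    then show "1 \<le> 6 * v\<^sup>2" using a(2) unfolding v_def by (simp add: field_simps)
  qed
  also have "\<dots> \<le> N * c0" using \<open>3 \<le> N\<close> c0_gt by (intro mult_right_mono) auto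
  finally show ?thesis using \<open>3 \<le> N\<close> unfolding a_def by (simp add: mult.commute)
qed

section \<open>Excluding all other configurations\<close>

lemma R4_le_c0_of_large:
  assumes large: "1000 \<le> d1 + d2 + d3"
  shows "R4 A (d1 + d2 + d3) \<le> c0"
proof (rule ccontr)
  define a where "a = real_of_int (d1 + d2 + d3)"
  define R where "R = R4 A (d1 + d2 + d3)"
  define \<theta> where "\<theta> = real_of_int e2 / real_of_int d2"
  define t1 where "t1 = d1 / a"
  define t2 where "t2 = d2 / a"
  define t3 where "t3 = d3 / a"
  assume "\<not> ?thesis"
  then have R: "c0 < R" unfolding R_def by simp
  have a: "1000 \<le> a" using large unfolding a_def by linarith
  have a_pos: "0 < a" using a by simp
  have R_eq: "R = A / a ^ 3" unfolding R_def R4_def a_def by simp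
  have t: "0 < t1" "0 < t2" "0 < t3"
    unfolding t1_def t2_def t3_def using a pos by (auto intro!: divide_pos_pos)
  have sum1: "t1 + t2 + t3 = 1"
    unfolding t1_def t2_def t3_def using a_pos a_def by (simp flip: add_divide_distrib)
  have th: "0 < \<theta>" "\<theta> < 1" unfolding \<theta>_def using pos e2_less by auto
  have area: "k * R \<le> \<theta> * ((x / a) * (y / a) * (z / a))"
    if "d2 * (k * A) \<le> e2 * (x * y * z)" for k x y z :: int
  proof -
    have "real_of_int (d2 * (k * A)) \<le> real_of_int (e2 * (x * y * z))"
      using that by (subst of_int_le_iff)
    then show ?thesis
      unfolding R_eq \<theta>_def using pos a_pos by (intro normalize_area) auto
  qed
  have aa: "real_of_int (d1 + d2 + d3) / a = 1" using a_pos unfolding a_def by simp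
  have bounds: "p * R \<le> \<theta> * (t1 * t2 * (t1 + t2))" "q * R \<le> \<theta> * (t2 * t3 * (t2 + t3))"
    "(p + m) * R \<le> \<theta> * (t1 * (1 - t1))" "(q + m) * R \<le> \<theta> * (t3 * (1 - t3))"
  proof -
    have c: "1 - t1 = t2 + t3" "1 - t3 = t1 + t2" using sum1 by auto
    show "p * R \<le> \<theta> * (t1 * t2 * (t1 + t2))" "q * R \<le> \<theta> * (t2 * t3 * (t2 + t3))"
      "(p + m) * R \<le> \<theta> * (t1 * (1 - t1))" "(q + m) * R \<le> \<theta> * (t3 * (1 - t3))"
      using scaled_areas[THEN area] unfolding aa c
      by (simp_all add: t1_def t2_def t3_def add_divide_distrib mult.commute)
  qed
  have R_pos: "0 < R" and R_gt: "4741 / 100000 < R" using R c0_gt by auto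
  have pR: "k * R \<le> l * R" if "k \<le> l" for k l :: real
    using that R_pos by (intro mult_right_mono) auto

  \<comment> \<open>The first area bound gives \<open>R <= t2\<close>, so \<open>d2\<close> exceeds
    0.04741 * 1000.\<close>
  have d2_large: "47 \<le> d2"
  proof -
    have "t1 * t2 * (t1 + t2) \<le> 1 * t2 * 1"
      using t sum1 by (intro mult_mono) auto
    then have "\<theta> * (t1 * t2 * (t1 + t2)) \<le> 1 * (1 * t2 * 1)"
      using t th by (intro mult_mono[of \<theta> 1]) auto
    then have "R \<le> t2" using bounds(1) pR[of 1 p] pqm_pos by simp
    then have "4741 / 100000 < d2 / a" using R_gt unfolding t2_def by linarith
    then have "4741 / 100000 * a < d2" using a_pos by (simp add: pos_less_divide_eq)
    then have "47 < real_of_int d2" using a by linarith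
    then show ?thesis by linarith
  qed

  have "p \<noteq> q"
  proof
    assume "p = q"
    then have "real_of_int A < real_of_int ((d1 + d2 + d3)\<^sup>2)"
      using parallel_chords by (subst of_int_less_iff)
    then have "real_of_int A < a\<^sup>2" unfolding a_def by simp
    then have "R < 1 / a" unfolding R_eq using a_pos
      by (simp add: divide_simps power2_eq_square power3_eq_cube)
    also have "\<dots> \<le> 1 / 1000" using a by (intro divide_left_mono) auto
    finally show False using R_gt by simp
  qed

  \<comment> \<open>\<open>p\<close> and \<open>q + m\<close> belong to the two triangles that tile
    the quadrilateral.\<close>
  have sum: "(p + q + m) * R \<le> \<theta> * (8 / 27)"
  proof -
    have "(p + q + m) * R = p * R + (q + m) * R" by (simp add: algebra_simps)
    also have "\<dots> \<le> \<theta> * (t1 * t2 * (t1 + t2)) + \<theta> * (t3 * (1 - t3))"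
      using bounds(1,4) by (rule add_mono)
    also have "\<dots> = \<theta> * (t1 * t2 * (t1 + t2) + t3 * (t1 + t2))"
    proof -
      have "1 - t3 = t1 + t2" using sum1 by auto
      then show ?thesis by (simp only: distrib_left)
    qed
    also have "\<dots> \<le> \<theta> * (8 / 27)"
      using t sum1 th by (intro mult_left_mono inscribed_quadrilateral_area) auto
    finally show ?thesis .
  qed

  have small_theta: False if "\<theta> \<le> x" "k \<le> p + q + m" "x * 8 * 100000 \<le> 4741 * 27 * k"
    for x k :: real
  proof -
    have "k * R \<le> x * (8 / 27)" using sum pR[OF that(2)] that(1) by linarith
    moreover have "x * (8 / 27) \<le> k * (4741 / 100000)" using that(3) by simp
    moreover have "k * (4741 / 100000) < k * R" if "0 < k"
      using R_gt that by (intro mult_strict_left_mono) auto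
    moreover have "0 < k" using that th by linarith
    ultimately show False by linarith
  qed
  have "p + q + m \<le> 6"
  proof (rule ccontr)
    assume "\<not> p + q + m \<le> 6"
    then have "7 \<le> real_of_int (p + q + m)" by linarith
    then show False using small_theta[of 1 7] th by simp
  qed

  have triangle: False
    if "0 \<le> c" "c \<le> 1 / 2" "k1 > 0" "k2 > 0" "0 < x" "\<theta> \<le> x"
      "x * (c * (1 - c)) \<le> k1 * (4741 / 100000)" "x * ((1 - c) ^ 3 / 4) \<le> k2 * (4741 / 100000)"
      "(p + m = k1 \<and> q = k2) \<or> (q + m = k1 \<and> p = k2)" for c x :: real and k1 k2 :: int
  proof -
    have big: "y < z" if "k > 0" "x * y \<le> k * (4741 / 100000)" "k * R \<le> \<theta> * z" "0 \<le> z"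
      for y z :: real and k :: int
    proof -
      have "k * (4741 / 100000) < k * R" using R_gt that(1) by simp
      moreover have "\<theta> * z \<le> x * z" using \<open>\<theta> \<le> x\<close> that(4) by (rule mult_right_mono)
      ultimately have "x * y < x * z" using that by linarith
      then show ?thesis using \<open>0 < x\<close> by simp
    qed
    have le1: "t1 \<le> 1" "t3 \<le> 1" using t sum1 by auto
    show False using that(9)
    proof
      assume k: "p + m = k1 \<and> q = k2"
      have "c * (1 - c) < t1 * (1 - t1)"
        by (rule big[OF that(3,7)]) (use bounds(3) k t le1 in auto)
      then have "t2 * t3 * (t2 + t3) \<le> (1 - c) ^ 3 / 4"
        using that(1,2) t sum1 by (intro inscribed_triangle_area[of t1]) auto
      moreover have "(1 - c) ^ 3 / 4 < t2 * t3 * (t2 + t3)"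
        by (rule big[OF that(4,8)]) (use bounds(2) k t in auto)
      ultimately show False by simp
    next
      assume k: "q + m = k1 \<and> p = k2"
      have "c * (1 - c) < t3 * (1 - t3)"
        by (rule big[OF that(3,7)]) (use bounds(4) k t le1 in auto)
      then have "t1 * t2 * (t1 + t2) \<le> (1 - c) ^ 3 / 4"
        using that(1,2) t sum1 by (intro inscribed_triangle_area[of t3]) auto
      moreover have "(1 - c) ^ 3 / 4 < t1 * t2 * (t1 + t2)"
        by (rule big[OF that(4,8)]) (use bounds(1) k t in auto)
      ultimately show False by simp
    qed
  qed

  \<comment> \<open>The margin 1/100 absorbs the error 18 / \<open>d2^2\<close>, which is at most 18
    / 2209.\<close>
  have theta_le: "\<theta> \<le> x" if "3 * e2\<^sup>2 \<le> l * d2\<^sup>2 + 18" "0 \<le> x" "l + 1 / 100 \<le> 3 * x\<^sup>2"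
    for x :: real and l :: int
  proof -
    have "(47 :: real)\<^sup>2 \<le> (real_of_int d2)\<^sup>2" using d2_large by (intro power_mono) auto
    then have "2209 \<le> (real_of_int d2)\<^sup>2" by simp
    moreover have "real_of_int (3 * e2\<^sup>2) \<le> real_of_int (l * d2\<^sup>2 + 18)"
      using that(1) by (subst of_int_le_iff)
    ultimately have "3 * (real_of_int e2)\<^sup>2 \<le> (l + 1 / 100) * (real_of_int d2)\<^sup>2"
      by (simp add: algebra_simps)
    also have "\<dots> \<le> 3 * x\<^sup>2 * (real_of_int d2)\<^sup>2"
      using that(3) by (intro mult_right_mono) auto
    finally have "(real_of_int e2)\<^sup>2 \<le> (x * d2)\<^sup>2" by (simp add: power_mult_distrib)
    then have "e2 \<le> x * d2" by (rule power2_le_imp_le) (use that pos in simp)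
    then show ?thesis using pos unfolding \<theta>_def by (simp add: field_simps)
  qed

  have pell_cases: False
    if k: "2 \<le> k" "k + m \<le> 5" and pq: "p = 1 \<and> q = k \<or> q = 1 \<and> p = k"
      and slope: "3 * e2\<^sup>2 \<le> 2 * d2\<^sup>2 + 18" "\<lbrakk>k = 2; m = 1\<rbrakk> \<Longrightarrow> 3 * e2\<^sup>2 \<le> d2\<^sup>2 + 18"
      and not_extremal: "\<not> (k = 2 \<and> m = 2)" for k
  proof -
    \<comment> \<open>0.82 lies just above \<open>sqrt (2 / 3)\<close>; likewise 0.6 below lies
      above \<open>sqrt (1 / 3)\<close>.\<close>
    have th82: "\<theta> \<le> 82 / 100" using theta_le[of 2 "82/100"] slope(1) by (simp add: power2_eq_square)
    have "(k = 2 \<and> m = 1) \<or> (k = 3 \<and> m = 1) \<or> k + m = 5"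
      using k pqm_pos(3) not_extremal by presburger
    then consider "k = 2" "m = 1" | "k = 3" "m = 1" | "k + m = 5" by auto
    then show False
    proof cases
      case 1
      then have "\<theta> \<le> 6 / 10" using theta_le[of 1 "6/10"] slope(2) by (simp add: power2_eq_square)
      moreover have "p + q + m = 4" using 1 pq by auto
      ultimately show False using small_theta[of "6/10" 4] by simp
    next
      case 2
      \<comment> \<open>With \<open>p + q + m = 5\<close> the quadrilateral bound just fails: 5 *
        0.04741 < 0.82 * 8 / 27. Two triangles, of determinants 2 and 3, are used instead;
        \<open>c\<close> is almost the largest value the first one allows.\<close>
      show False
        using triangle[of "1334/10000" 2 3 "82/100"] th82 2 pq
        by (auto simp: power3_eq_cube)
    next
      case 3
      then have "p + q + m = 6" using pq by auto
      then show False using small_theta[of "82/100" 6] th82 by simp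
    qed
  qed

  consider "p = 1" "2 \<le> q" | "q = 1" "2 \<le> p" | "2 \<le> p" "2 \<le> q"
    using pqm_pos \<open>p \<noteq> q\<close> by linarith
  then show False
  proof cases
    case 1
    have "(d1 * e2 - d2 * e1)\<^sup>2 = p\<^sup>2" unfolding p_def by algebra
    then have det: "(d1 * e2 - d2 * e1)\<^sup>2 = 1" using 1 by simp
    have "q + m \<le> 5" using 1 \<open>p + q + m \<le> 6\<close> by simp
    note slope = gap_form_slope[OF gap_form_front[OF 1(1)] det pos(5) e2_less d2_large
        1(2) pqm_pos(3) this]
    show False
    proof (cases "q = 2 \<and> m = 2")
      case True
      then show False using extremal_front[OF 1(1)] slope(3) R unfolding R_def by auto
    next
      case False
      then show False using pell_cases[of q] 1 \<open>q + m \<le> 5\<close> slope(1,2) by auto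
    qed
  next
    case 2
    have "(d3 * e2 - d2 * e3)\<^sup>2 = q\<^sup>2" unfolding q_def by algebra
    then have det: "(d3 * e2 - d2 * e3)\<^sup>2 = 1" using 2 by simp
    have "p + m \<le> 5" using 2 \<open>p + q + m \<le> 6\<close> by simp
    note slope = gap_form_slope[OF gap_form_back[OF 2(1)] det pos(5) e2_less d2_large
        2(2) pqm_pos(3) this]
    show False
    proof (cases "p = 2 \<and> m = 2")
      case True
      then show False using extremal_back[OF _ 2(1)] slope(3) R unfolding R_def by auto
    next
      case False
      then show False using pell_cases[of p] 2 \<open>p + m \<le> 5\<close> slope(1,2) by auto
    qed
  next
    case 3
    then have "m = 1" "(p = 2 \<and> q = 3) \<or> (p = 3 \<and> q = 2)"
      using pqm_pos \<open>p \<noteq> q\<close> \<open>p + q + m \<le> 6\<close> by presburger+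
    \<comment> \<open>Both determinants are 3 here: the smaller of \<open>p\<close>,
      \<open>q\<close> plus \<open>m\<close>, and the larger one. This \<open>c\<close> meets both
      numerical conditions with only slope 1.\<close>
    then show False
      using triangle[of "1717/10000" 3 3 1] th by (auto simp: power3_eq_cube)
  qed
qed

end

section \<open>The upper bound for factorizations\<close>

lemma four_hyperbola_points_of_factorizations:
  assumes "four_close_factorizations n A B a1 a2 a3 b1 b2 b3"
  shows "four_hyperbola_points A B a1 (a2 - a1) (a3 - a2) b1 (b2 - b1) (b3 - b2)"
  using assms unfolding four_close_factorizations_def
  by unfold_locales (simp_all add: algebra_simps)

lemma (in four_hyperbola_points) A_le_cube: "A \<le> (d1 + d2 + d3) ^ 3"
proof -
  have "A * 1 \<le> A * p" using pos pqm_pos by (intro mult_left_mono) auto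
  also have "\<dots> = d1 * (d1 + d2) * e2" by (rule areas)
  also have "\<dots> \<le> (d1 + d2 + d3) * (d1 + d2 + d3) * (d1 + d2 + d3)"
    using pos e2_less by (intro mult_mono) auto
  finally show ?thesis by (simp add: power3_eq_cube)
qed

lemma R4_le_c0:
  assumes F: "four_close_factorizations n A B a1 a2 a3 b1 b2 b3" and n: "10 ^ 18 \<le> n"
  shows "R4 A a3 \<le> c0"
proof -
  interpret four_hyperbola_points A B a1 "a2 - a1" "a3 - a2" b1 "b2 - b1" "b3 - b2"
    using F by (rule four_hyperbola_points_of_factorizations)
  have "n \<le> A * A"
    using F unfolding four_close_factorizations_def by (auto intro: mult_left_mono)
  also have "\<dots> \<le> a3 ^ 3 * a3 ^ 3" using A_le_cube pos by (intro mult_mono) auto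
  \<comment> \<open>The threshold \<open>10 ^ 18\<close> is \<open>1000 ^ 6\<close>, matching
    \<open>n <= A^2 <= a3^6\<close>.\<close>
  finally have "1000 ^ 6 \<le> a3 ^ 6" using n by (simp flip: power_add)
  then have "1000 \<le> a3"
    using power_mono_iff[of 1000 a3 6] pos by simp
  then show ?thesis using R4_le_c0_of_large by simp
qed

section \<open>Sharpness through the Pell equation\<close>

lemma pell_6_unbounded: "\<exists>x y :: int. x\<^sup>2 = 6 * y\<^sup>2 + 1 \<and> 0 < x \<and> int k < y"
proof (induction k)
  case 0
  have "(5::int)\<^sup>2 = 6 * 2\<^sup>2 + 1 \<and> 0 < (5::int) \<and> int 0 < 2" by simp
  then show ?case by blast
next
  case (Suc k)
  then obtain x y :: int where "x\<^sup>2 = 6 * y\<^sup>2 + 1" "0 < x" "int k < y" by blast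
  \<comment> \<open>Multiplication of \<open>x + y * sqrt 6\<close> by the unit
    \<open>5 + 2 * sqrt 6\<close>.\<close>
  then have "(5 * x + 12 * y)\<^sup>2 = 6 * (2 * x + 5 * y)\<^sup>2 + 1 \<and> 0 < 5 * x + 12 * y
      \<and> int (Suc k) < 2 * x + 5 * y"
    by (auto simp: power2_eq_square algebra_simps)
  then show ?case by blast
qed

text \<open>This family realises \<open>(p, q, m) = (1, 2, 2)\<close>, with
  \<open>d\<^sub>1\<^sup>2 - 6 d\<^sub>1 d\<^sub>2 + 3 d\<^sub>2\<^sup>2 = 3\<close>.\<close>

lemma pell_family:
  fixes x y :: int
  assumes pell: "x\<^sup>2 = 6 * y\<^sup>2 + 1" and pos: "0 < x" "0 < y"
  defines "A \<equiv> 3 * y * (x + 6 * y) * (x + 2 * y)" and "B \<equiv> 2 * x * (x + y) * (x + 3 * y)"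
  shows "four_close_factorizations (A * B) A B (3 * y) (x + 6 * y) (3 * x + 6 * y)
    x (2 * x + 2 * y) (2 * x + 6 * y)"
    and "R4 A (3 * x + 6 * y) = (sqrt (6 + 1 / y\<^sup>2) + 6) / (9 * (sqrt (6 + 1 / y\<^sup>2) + 2)\<^sup>2)"
    and "y \<le> A * B"
proof -
  have A: "y \<le> A"
  proof -
    have "y * 1 * 1 \<le> 3 * y * (x + 6 * y) * (x + 2 * y)" using pos by (intro mult_mono) auto
    then show ?thesis unfolding A_def by simp
  qed
  have "0 < B" unfolding B_def using pos by simp
  have "y * 1 \<le> A * B" using A \<open>0 < B\<close> pos by (intro mult_mono) auto
  then show "y \<le> A * B" by simp
  have "0 < y\<^sup>2" "(3 * y)\<^sup>2 = 9 * y\<^sup>2" using pos by (simp_all add: power_mult_distrib)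
  then have "x\<^sup>2 < (3 * y)\<^sup>2" using pell by linarith
  then have "x < 3 * y" by (rule power2_less_imp_less) (use pos in simp)
  have diff: "A - B = 6 * y * (x * y) + 6 * y * (y * y) - 2 * x - 5 * y"
    using pell unfolding A_def B_def by algebra
  have "1 * x \<le> y * (x * y)" using pos mult_mono[of 1 y 1 y] by (simp add: mult.left_commute)
  moreover have "y * 1 \<le> y * (y * y)" using pos mult_mono[of 1 y 1 y] by (intro mult_left_mono) auto
  ultimately have "B \<le> A" using diff pos by linarith
  have eqs: "A * B = (A + 3 * y) * (B - x)"
    "A * B = (A + (x + 6 * y)) * (B - (2 * x + 2 * y))"
    "A * B = (A + (3 * x + 6 * y)) * (B - (2 * x + 6 * y))"
    using pell unfolding A_def B_def by algebra+
  show "four_close_factorizations (A * B) A B (3 * y) (x + 6 * y) (3 * x + 6 * y)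
    x (2 * x + 2 * y) (2 * x + 6 * y)"
    unfolding four_close_factorizations_def
    using \<open>0 < B\<close> \<open>B \<le> A\<close> pos \<open>x < 3 * y\<close> by (intro conjI eqs refl) auto
  \<comment> \<open>\<open>A\<close> and the cube of \<open>a3\<close> are homogeneous of degree 3
    in \<open>x\<close> and \<open>y\<close>, so the ratio depends only on \<open>w\<close>, which
    tends to \<open>sqrt 6\<close>.\<close>
  define w where "w = real_of_int x / real_of_int y"
  have "real_of_int (x\<^sup>2) = real_of_int (6 * y\<^sup>2 + 1)" using pell by simp
  then have "w\<^sup>2 = 6 + 1 / y\<^sup>2" using pos unfolding w_def by (simp add: field_simps)
  moreover have "0 < w" unfolding w_def using pos by simp
  ultimately have sqrt: "sqrt (6 + 1 / y\<^sup>2) = w" by (metis less_imp_le real_sqrt_unique)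
  have x: "real_of_int x = w * y" using pos unfolding w_def by simp
  have "R4 A (3 * x + 6 * y) = (3 * y * (w * y + 6 * y) * (w * y + 2 * y)) / (3 * (w * y) + 6 * y) ^ 3"
    unfolding R4_def A_def by (simp add: x)
  also have "\<dots> = (3 * y ^ 3 * ((w + 6) * (w + 2))) / (27 * y ^ 3 * (w + 2) ^ 3)"
    by (simp add: algebra_simps power3_eq_cube)
  also have "\<dots> = (w + 6) / (9 * (w + 2)\<^sup>2)"
    using pos \<open>0 < w\<close>
    by (simp add: divide_simps power2_eq_square power3_eq_cube) (simp add: algebra_simps)
  finally show "R4 A (3 * x + 6 * y) = (sqrt (6 + 1 / y\<^sup>2) + 6) / (9 * (sqrt (6 + 1 / y\<^sup>2) + 2)\<^sup>2)"
    unfolding sqrt .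
qed

lemma pell_family_ratio_limit:
  "(\<lambda>k. (sqrt (6 + 1 / (real k)\<^sup>2) + 6) / (9 * (sqrt (6 + 1 / (real k)\<^sup>2) + 2)\<^sup>2)) \<longlonglongrightarrow> c0"
proof -
  have "(\<lambda>k. 1 / (real k)\<^sup>2) \<longlonglongrightarrow> 0"
    using tendsto_power[OF lim_1_over_n, of 2] by (simp add: power_divide)
  then have "(\<lambda>k. (sqrt (6 + 1 / (real k)\<^sup>2) + 6) / (9 * (sqrt (6 + 1 / (real k)\<^sup>2) + 2)\<^sup>2))
      \<longlonglongrightarrow> (sqrt (6 + 0) + 6) / (9 * (sqrt (6 + 0) + 2)\<^sup>2)"
    by (intro tendsto_intros) (auto simp: add_nonneg_eq_0_iff)
  then show ?thesis unfolding c0_def by (simp add: add.commute)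
qed

lemma c0_approached:
  assumes "c < c0"
  shows "\<exists>n\<ge>N. \<exists>A B a1 a2 a3 b1 b2 b3.
    four_close_factorizations n A B a1 a2 a3 b1 b2 b3 \<and> R4 A a3 > c"
proof -
  obtain k0 where k0: "\<And>k. k \<ge> k0 \<Longrightarrow>
      c < (sqrt (6 + 1 / (real k)\<^sup>2) + 6) / (9 * (sqrt (6 + 1 / (real k)\<^sup>2) + 2)\<^sup>2)"
    using order_tendstoD(1)[OF pell_family_ratio_limit assms]
    unfolding eventually_sequentially by blast
  \<comment> \<open>One lower bound on \<open>y\<close> serves both needs: \<open>y >= k0\<close>
    puts the ratio above \<open>c\<close>, and \<open>n >= y >= N\<close> makes \<open>n\<close>
    large.\<close>
  obtain x y :: int where xy: "x\<^sup>2 = 6 * y\<^sup>2 + 1" "0 < x" "int (k0 + nat N) < y"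
    using pell_6_unbounded by blast
  then have "0 < y" "k0 \<le> nat y" "N \<le> y" by linarith+
  note fam = pell_family[OF xy(1,2) this(1)]
  show ?thesis
    using fam(1,2,3) k0[OF \<open>k0 \<le> nat y\<close>] \<open>0 < y\<close> \<open>N \<le> y\<close>
    by (intro exI conjI) (auto intro: order_trans)
qed

theorem theorem2:
  shows "(\<exists>(K::real) > 0. \<exists>N0::int. \<forall>n\<ge>N0. \<forall>A B a1 a2 a3 b1 b2 b3.
            four_close_factorizations n A B a1 a2 a3 b1 b2 b3 \<longrightarrow>
            R4 A a3 \<le> c0 + K / root 3 (real_of_int n))
       \<and> (\<forall>c<c0. \<forall>N::int. \<exists>n\<ge>N. \<exists>A B a1 a2 a3 b1 b2 b3.
            four_close_factorizations n A B a1 a2 a3 b1 b2 b3 \<and> R4 A a3 > c)"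
proof
  \<comment> \<open>\<open>R4 <= c0\<close> already holds for \<open>n >= 10 ^ 18\<close>, which
    yields the witnesses \<open>K = 1\<close> and \<open>N0 = 10 ^ 18\<close>.\<close>
  have "R4 A a3 \<le> c0 + 1 / root 3 (real_of_int n)"
    if "10 ^ 18 \<le> n" "four_close_factorizations n A B a1 a2 a3 b1 b2 b3"
    for n A B a1 a2 a3 b1 b2 b3
  proof -
    have "0 \<le> 1 / root 3 (real_of_int n)" using that(1) by simp
    then show ?thesis using R4_le_c0[OF that(2,1)] by linarith
  qed
  then show "\<exists>(K::real) > 0. \<exists>N0::int. \<forall>n\<ge>N0. \<forall>A B a1 a2 a3 b1 b2 b3.
      four_close_factorizations n A B a1 a2 a3 b1 b2 b3 \<longrightarrow>
      R4 A a3 \<le> c0 + K / root 3 (real_of_int n)"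
    by (intro exI[of _ "1::real"] conjI exI[of _ "10 ^ 18 :: int"] allI impI) auto
qed (use c0_approached in blast)

end
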